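(* Let $F_0:[0,\infty)\to[0,\infty)$ be a Lipschitz function with $0\le F_0(x)\le x$ for all $x\ge0$, with $F_0$ sublinear and $0\le\partial_xF_0\le1$ a.e. on $[0,\infty)$. Assume that, for some given $\delta>0$, $$\lim_{x\to\infty}\frac{F_0(x)}{x^{2/3}}=\delta.$$ Let $F$ be the unique viscosity solution of $$\begin{cases}\partial_tF+\tfrac12(\partial_xF-1)(\partial_xF-2)+\dfrac Fx-1=0&\text{in }(0,\infty)^2,\\ 0\le F(x,t)\le x&\text{on }[0,\infty)^2,\\ F(x,0)=F_0(x)&\text{on }[0,\infty),\end{cases}$$ and let $c=\frac{27}{8\delta^3}$. Then, as $t\to\infty$, $$F(x,t)\to\frac1c\,\bar F(cx)\qquad\text{locally uniformly for }x\in[0,\infty),$$ where $\bar F:[0,\infty)\to[0,\infty)$ is the function determined by $\bar F(0)=0$ and, for $x>0$, $$\partial_x\bar F(x)=\frac{1}{\sqrt x}\left[\left(\frac{\sqrt{x+x_0}+\sqrt x}{2}\right)^{1/3}-\left(\frac{\sqrt{x+x_0}-\sqrt x}{2}\right)^{1/3}\right],\qquad x_0=\frac{4}{27}.$$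
   Context: A function $g$ on $[0,\infty)$ is sublinear if $\lim_{x\to\infty}g(x)/x=0$. Solutions are continuous on $[0,\infty)^2$ and are understood in the viscosity sense, with $F=F(x,t)$, $x$ the space variable and $t$ the time variable. Under the stated assumptions on $F_0$ (namely $0\le F_0(x)\le x$, sublinearity, $0\le\partial_xF_0\le1$), the problem has a unique (sublinear in $x$) viscosity solution $F$, which is known to be globally Lipschitz and to satisfy $0\le\partial_xF\le1$ a.e. on $[0,\infty)^2$. Locally uniformly means uniformly on compact subsets of $[0,\infty)$. The function $\bar F$ is continuous on $[0,\infty)$. *)

theory Defs
  imports "HOL-Analysis.Analysis"
begin

definition sublinear :: "(real \<Rightarrow> real) \<Rightarrow> bool" where
  "sublinear g \<longleftrightarrow> ((\<lambda>x. g x / x) \<longlongrightarrow> 0) at_top"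

(* phi is continuously differentiable on the open set Omega, with gradient field D *)
definition C1_test :: "'a::real_inner set \<Rightarrow> ('a \<Rightarrow> real) \<Rightarrow> ('a \<Rightarrow> 'a) \<Rightarrow> bool" where
  "C1_test \<Omega> \<phi> D \<longleftrightarrow> continuous_on \<Omega> D \<and> (\<forall>z\<in>\<Omega>. GDERIV \<phi> z :> D z)"

(* Viscosity sub- and supersolutions in the open set Omega of the first-order equation
   E z (u z) (grad u z) = 0, for a continuous function u. *)

definition viscosity_subsolution ::
  "'a::real_inner set \<Rightarrow> ('a \<Rightarrow> real \<Rightarrow> 'a \<Rightarrow> real) \<Rightarrow> ('a \<Rightarrow> real) \<Rightarrow> bool" where
  "viscosity_subsolution \<Omega> E u \<longleftrightarrow>
     (\<forall>\<phi> D. \<forall>z\<in>\<Omega>. C1_test \<Omega> \<phi> D \<longrightarrow>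
        (\<forall>\<^sub>F y in at z within \<Omega>. u y - \<phi> y \<le> u z - \<phi> z) \<longrightarrow> E z (u z) (D z) \<le> 0)"

definition viscosity_supersolution ::
  "'a::real_inner set \<Rightarrow> ('a \<Rightarrow> real \<Rightarrow> 'a \<Rightarrow> real) \<Rightarrow> ('a \<Rightarrow> real) \<Rightarrow> bool" where
  "viscosity_supersolution \<Omega> E u \<longleftrightarrow>
     (\<forall>\<phi> D. \<forall>z\<in>\<Omega>. C1_test \<Omega> \<phi> D \<longrightarrow>
        (\<forall>\<^sub>F y in at z within \<Omega>. u y - \<phi> y \<ge> u z - \<phi> z) \<longrightarrow> E z (u z) (D z) \<ge> 0)"

definition viscosity_solution ::
  "'a::real_inner set \<Rightarrow> ('a \<Rightarrow> real \<Rightarrow> 'a \<Rightarrow> real) \<Rightarrow> ('a \<Rightarrow> real) \<Rightarrow> bool" where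
  "viscosity_solution \<Omega> E u \<longleftrightarrow>
     viscosity_subsolution \<Omega> E u \<and> viscosity_supersolution \<Omega> E u"

(* Points of the quadrant are pairs (x, t) (space, time); correspondingly the gradient slot
   is (p, q) with p for the x-derivative and q for the t-derivative. *)
definition CF_equation :: "real \<times> real \<Rightarrow> real \<Rightarrow> real \<times> real \<Rightarrow> real" where
  "CF_equation = (\<lambda>(x, t) r (p, q). q + 1/2 * (p - 1) * (p - 2) + r / x - 1)"

(* Sublinearity in x is part of the class in which the problem is uniquely solvable. *)
definition CF_solution :: "(real \<Rightarrow> real) \<Rightarrow> (real \<times> real \<Rightarrow> real) \<Rightarrow> bool" where
  "CF_solution F0 F \<longleftrightarrow>
     continuous_on ({0..} \<times> {0..}) F \<and>
     viscosity_solution ({0<..} \<times> {0<..}) CF_equation F \<and>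
     (\<forall>x\<ge>0. \<forall>t\<ge>0. 0 \<le> F (x, t) \<and> F (x, t) \<le> x) \<and>
     (\<forall>x\<ge>0. F (x, 0) = F0 x) \<and>
     (\<forall>t\<ge>0. sublinear (\<lambda>x. F (x, t)))"

end

theory Submission
  imports Defs "HOL-Real_Asymp.Real_Asymp"
begin

text \<open>
Write the equation as \<open>\<partial>\<^sub>t F + H (\<partial>\<^sub>x F) + F / x = 0\<close> with \<open>H p = p (p - 3) / 2\<close>.
The steady profile has a rational parametrization: if \<open>s\<^sup>3 + s = \<surd>x\<close>, then
\<open>p = 1 / (1 + s\<^sup>2)\<close> and \<open>f = s\<^sup>2 + 3/2 s\<^sup>4\<close> satisfy \<open>df/dx = p\<close> and \<open>f / x = p (3 - p) / 2\<close>.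
The derivative prescribed for \<open>Fbar\<close> is Cardano's expression for \<open>s / \<surd>x = p\<close>, so
\<open>Fbar = f\<close>.  By scaling, \<open>f (\<kappa> x) / \<kappa>\<close> is a steady solution for every \<open>\<kappa> > 0\<close>, and it grows
like \<open>3/2 \<kappa> powr (-1/3) x powr (2/3)\<close>; the value \<open>\<kappa> = c\<close> is the one whose growth is that
of \<open>F0\<close>.

For slopes between 0 and 1 the characteristic speed \<open>H' p = p - 3/2\<close> is at most \<open>-1/2\<close>:
information travels towards \<open>x = 0\<close>, so the long-time behaviour on compact sets is dictated
by the initial datum far away.  This becomes a proof by comparison with explicit barriers.
Take \<open>\<kappa> < c\<close>.  Then the rescaled profile lies above \<open>F0\<close> outside a bounded set, and the
discrepancy on that set is covered by the decreasing wave \<open>exp (- k (x + t/2)) / k\<close> of speed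
\<open>-1/2\<close>.  The sum is a supersolution, and it stays one after adding \<open>\<eta> exp (x + 3 t)\<close>, which
forces a contact point with \<open>F\<close> to exist if \<open>F\<close> ever exceeds the barrier.  Since the
barriers are smooth they serve as test functions themselves, and comparison amounts to
evaluating the equation at a maximum of the difference
(\<open>viscosity_subsolution_le\<close>, \<open>CF_solution_le_profile\<close>).  Letting \<open>\<eta>\<close> tend to 0 and then \<open>t\<close> to
infinity bounds \<open>F\<close> from above by the profile of parameter \<open>\<kappa>\<close>.  For \<open>\<kappa> > c\<close> the lower bound
is the mirror image (\<open>CF_solution_ge_profile\<close>), except that the penalization must now have
small slope: \<open>\<eta> (x + 2 t)\<close> suffices because the profile is sublinear and \<open>F\<close> is nonnegative.
Finally \<open>\<kappa>\<close> tends to \<open>c\<close>, the profiles depending on \<open>\<kappa>\<close> locally uniformly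
(\<open>rescaled_profile_dist\<close>).
\<close>

section \<open>The steady profile\<close>

definition cardano :: "real \<Rightarrow> real" where
  "cardano x = ((sqrt (x + 4/27) + sqrt x) / 2) powr (1/3)
             - ((sqrt (x + 4/27) - sqrt x) / 2) powr (1/3)"

text \<open>
This is Cardano's formula: with \<open>a\<close> and \<open>b\<close> the two cube roots, \<open>a\<^sup>3 - b\<^sup>3 = \<surd>x\<close>, and the shift
\<open>4/27\<close> is the value that makes \<open>a b = 1/3\<close>, hence \<open>(a - b)\<^sup>3 = a\<^sup>3 - b\<^sup>3 - (a - b)\<close>.
\<close>

lemma cardano_cubic:
  assumes "x \<ge> 0"
  shows "cardano x ^ 3 + cardano x = sqrt x"
proof -
  define u where "u = (sqrt (x + 4/27) + sqrt x) / 2"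
  define v where "v = (sqrt (x + 4/27) - sqrt x) / 2"
  define a where "a = u powr (1/3)"
  define b where "b = v powr (1/3)"
  have uv: "u > 0" "v > 0"
    using assms by (auto simp: u_def v_def intro!: add_pos_nonneg)
  have a3: "a ^ 3 = u" and b3: "b ^ 3 = v"
    using uv by (simp_all add: a_def b_def powr_power)
  have "u * v = (sqrt (x + 4/27) ^ 2 - sqrt x ^ 2) / 4"
    by (simp add: u_def v_def power2_eq_square algebra_simps)
  also have "\<dots> = (1/3) ^ 3"
    using assms by (simp add: power3_eq_cube)
  finally have "(a * b) ^ 3 = (1/3) ^ 3"
    by (simp add: power_mult_distrib a3 b3)
  hence ab: "a * b = 1/3"
    by (rule power_eq_imp_eq_base) (auto simp: a_def b_def)
  have "(a - b) ^ 3 + (a - b) = a ^ 3 - b ^ 3 + (a - b) * (1 - 3 * (a * b))"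
    by (simp add: power3_eq_cube algebra_simps)
  also have "\<dots> = sqrt x"
    by (simp add: ab a3 b3) (simp add: u_def v_def field_simps)
  finally show ?thesis
    by (simp add: cardano_def a_def b_def u_def v_def)
qed

lemma cardano_factored:
  assumes "x \<ge> 0"
  shows "cardano x * (1 + cardano x ^ 2) = sqrt x"
  using cardano_cubic[OF assms] by (simp add: power3_eq_cube power2_eq_square algebra_simps)

lemma cardano_pos: "x > 0 \<Longrightarrow> cardano x > 0"
  using cardano_factored[of x]
  by (metis add_pos_nonneg less_eq_real_def real_sqrt_gt_zero zero_le_power2 zero_less_mult_pos2 zero_less_one)

lemma cardano_0 [simp]: "cardano 0 = 0"
  by (simp add: cardano_def)

lemma continuous_on_cardano: "continuous_on {0..} cardano"
proof -
  have "sqrt (x + 4/27) + sqrt x \<noteq> 0" if "x \<ge> 0" for x :: real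
    using add_pos_nonneg[of "sqrt (x + 4/27)" "sqrt x"] that by simp
  thus ?thesis
    unfolding cardano_def by (intro continuous_intros) auto
qed

lemma cardano_at_top: "filterlim cardano at_top at_top"
  unfolding cardano_def by real_asymp

text \<open>
Exhibits \<open>cardano\<close> as the inverse of a polynomial, from which its derivative is read off
without differentiating the nested roots.
\<close>

lemma cardano_square_inverse:
  assumes "x \<ge> 0"
  shows "(cardano x * (1 + cardano x ^ 2)) ^ 2 = x"
  using assms by (simp add: cardano_factored)

lemma has_real_derivative_cardano:
  assumes "x > 0"
  shows "(cardano has_real_derivative
     inverse (2 * (cardano x * (1 + cardano x ^ 2)) * (1 + 3 * cardano x ^ 2))) (at x)"
proof (rule DERIV_inverse_function[where a = 0 and b = "x + 1"
      and f = "\<lambda>s. (s * (1 + s ^ 2)) ^ 2"])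
  let ?s = "cardano x"
  show "((\<lambda>s. (s * (1 + s ^ 2)) ^ 2) has_real_derivative
      2 * (?s * (1 + ?s ^ 2)) * (1 + 3 * ?s ^ 2)) (at ?s)"
    by (auto intro!: derivative_eq_intros simp: power2_eq_square algebra_simps)
  show "2 * (?s * (1 + ?s ^ 2)) * (1 + 3 * ?s ^ 2) \<noteq> 0"
    using cardano_pos[OF assms] add_pos_nonneg[of 1 "?s ^ 2"] add_pos_nonneg[of 1 "3 * ?s ^ 2"]
    by simp
  show "isCont cardano x"
    using continuous_on_interior[OF continuous_on_cardano, of x] assms by simp
  show "(cardano y * (1 + cardano y ^ 2)) ^ 2 = y" if "0 < y" "y < x + 1" for y
    using that by (intro cardano_square_inverse) simp
qed (use assms in auto)

definition profile_slope :: "real \<Rightarrow> real" where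
  "profile_slope x = 1 / (1 + cardano x ^ 2)"

definition profile :: "real \<Rightarrow> real" where
  "profile x = cardano x ^ 2 + 3/2 * cardano x ^ 4"

lemma profile_slope_bounds: "0 < profile_slope x" "profile_slope x \<le> 1"
  by (auto simp: profile_slope_def add_pos_nonneg field_simps)

lemma continuous_on_profile_slope: "continuous_on {0..} profile_slope"
  unfolding profile_slope_def
  by (intro continuous_intros continuous_on_cardano)
     (metis add_pos_nonneg less_irrefl zero_le_power2 zero_less_one)

lemma profile_slope_tendsto_0: "(profile_slope \<longlongrightarrow> 0) at_top"
proof -
  have "((\<lambda>s::real. 1 / (1 + s ^ 2)) \<longlongrightarrow> 0) at_top"
    by real_asymp
  from filterlim_compose[OF this cardano_at_top] show ?thesis
    by (simp add: profile_slope_def[abs_def])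
qed

lemma continuous_on_profile: "continuous_on {0..} profile"
  unfolding profile_def by (intro continuous_intros continuous_on_cardano)

lemma profile_0 [simp]: "profile 0 = 0"
  by (simp add: profile_def)

text \<open>
This is the stationary equation \<open>H p + f / x = 0\<close>, with \<open>f\<close> the profile and \<open>p\<close> its slope.
\<close>

lemma profile_steady:
  assumes "x > 0"
  shows "profile x / x = profile_slope x * (3 - profile_slope x) / 2"
proof -
  define s where "s = cardano x"
  have s: "s > 0" using cardano_pos[OF assms] by (simp add: s_def)
  have x: "x = (s * (1 + s ^ 2)) ^ 2"
    using cardano_square_inverse[of x] assms by (simp add: s_def)
  have q: "1 + s ^ 2 > 0" by (simp add: add_pos_nonneg)
  have "(s ^ 2 + 3/2 * s ^ 4) / (s * (1 + s ^ 2)) ^ 2 = 1 / (1 + s ^ 2) * (3 - 1 / (1 + s ^ 2)) / 2"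
    using s q by (simp add: divide_simps) algebra
  thus ?thesis
    unfolding profile_def profile_slope_def s_def[symmetric] by (subst x) simp
qed

lemma has_real_derivative_profile:
  assumes "x > 0"
  shows "(profile has_real_derivative profile_slope x) (at x)"
proof -
  define s where "s = cardano x"
  have s: "s > 0" using cardano_pos[OF assms] by (simp add: s_def)
  have q: "1 + s ^ 2 > 0" "1 + 3 * s ^ 2 > 0" by (simp_all add: add_pos_nonneg)
  have "(profile has_real_derivative
      (2 * s + 6 * s ^ 3) * inverse (2 * (s * (1 + s ^ 2)) * (1 + 3 * s ^ 2))) (at x)"
    unfolding profile_def s_def
    by (auto intro!: derivative_eq_intros has_real_derivative_cardano[OF assms]
        simp: algebra_simps)
  moreover have "2 * s + 6 * s ^ 3 = 2 * s * (1 + 3 * s ^ 2)"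
    by (simp add: power3_eq_cube power2_eq_square algebra_simps)
  moreover have "2 * s * (1 + 3 * s ^ 2) * inverse (2 * (s * (1 + s ^ 2)) * (1 + 3 * s ^ 2))
      = 1 / (1 + s ^ 2)"
  proof -
    have "2 * s * r * inverse (2 * (s * q) * r) = 1 / q" if "q \<noteq> 0" "r \<noteq> 0" for q r :: real
      using that s by (simp add: field_simps)
    from this[of "1 + s ^ 2" "1 + 3 * s ^ 2"] q show ?thesis
      by simp
  qed
  ultimately show ?thesis
    by (simp add: profile_slope_def s_def)
qed

text \<open>
In terms of \<open>s = cardano x\<close>, the profile is equivalent to \<open>3/2 s\<^sup>4\<close> and \<open>x\<close> to \<open>s\<^sup>6\<close>.
\<close>

lemma profile_asymptotics: "((\<lambda>x. profile x / x powr (2/3)) \<longlongrightarrow> 3/2) at_top"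
proof -
  have "((\<lambda>s::real. (s ^ 2 + 3/2 * s ^ 4) / ((s * (1 + s ^ 2)) ^ 2) powr (2/3)) \<longlongrightarrow> 3/2) at_top"
    by real_asymp
  from filterlim_compose[OF this cardano_at_top]
  have lim: "((\<lambda>x. profile x / ((cardano x * (1 + cardano x ^ 2)) ^ 2) powr (2/3)) \<longlongrightarrow> 3/2) at_top"
    by (simp add: profile_def)
  show ?thesis
    by (rule Lim_transform_eventually[OF lim])
       (auto intro!: eventually_mono[OF eventually_ge_at_top[of 0]] simp: cardano_square_inverse)
qed

lemma profile_nonneg: "profile x \<ge> 0"
  by (simp add: profile_def)

lemma profile_diff_le:
  assumes "0 \<le> x" "x \<le> y"
  shows "0 \<le> profile y - profile x" "profile y - profile x \<le> y - x"
proof -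
  have "0 \<le> profile y - profile x \<and> profile y - profile x \<le> y - x"
  proof (cases "x = y")
    case False
    with assms have xy: "x < y" by simp
    obtain z where z: "x < z" "z < y" "profile y - profile x = (y - x) * profile_slope z"
    proof -
      have "\<exists>l z. z > x \<and> z < y \<and> DERIV profile z :> l \<and> profile y - profile x = (y - x) * l"
      proof (rule MVT[OF xy])
        show "continuous_on {x..y} profile"
          using assms by (intro continuous_on_subset[OF continuous_on_profile]) auto
        show "profile differentiable (at z)" if "x < z" "z < y" for z
          using has_real_derivative_profile[of z] that assms
          by (auto simp: real_differentiable_def)
      qed
      then obtain l z where "z > x" "z < y" "DERIV profile z :> l"
        "profile y - profile x = (y - x) * l" by blast
      moreover have "l = profile_slope z"
        using DERIV_unique[OF \<open>DERIV profile z :> l\<close> has_real_derivative_profile] assms \<open>z > x\<close>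
        by simp
      ultimately show ?thesis using that by simp
    qed
    then show ?thesis
      using xy profile_slope_bounds[of z] by (simp add: mult_left_le)
  qed auto
  thus "0 \<le> profile y - profile x" "profile y - profile x \<le> y - x" by auto
qed

lemma profile_unique:
  fixes f :: "real \<Rightarrow> real"
  assumes "continuous_on {0..} f" "f 0 = 0"
    and "\<And>x. x > 0 \<Longrightarrow> (f has_real_derivative 1 / sqrt x * cardano x) (at x)"
    and "x \<ge> 0"
  shows "f x = profile x"
proof (cases "x = 0")
  case False
  with assms have x: "0 < x" by simp
  have "f x - profile x = f 0 - profile 0"
  proof (rule DERIV_isconst_end[OF x])
    show "continuous_on {0..x} (\<lambda>y. f y - profile y)"
      by (intro continuous_intros continuous_on_subset[OF assms(1)]
          continuous_on_subset[OF continuous_on_profile]) auto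
    fix y :: real assume y: "0 < y" "y < x"
    have "1 / sqrt y * cardano y = profile_slope y"
      using cardano_factored[of y] cardano_pos[of y] y
      by (simp add: profile_slope_def flip: cardano_factored)
    with assms(3)[of y] y
    have "(f has_real_derivative profile_slope y) (at y)" by simp
    from DERIV_diff[OF this has_real_derivative_profile] y
    show "DERIV (\<lambda>y. f y - profile y) y :> 0" by simp
  qed
  thus ?thesis using assms by simp
qed (use assms in simp)

section \<open>Comparison with smooth barriers\<close>

text \<open>
At a positive interior maximum of \<open>u - \<phi>\<close> the barrier \<open>\<phi>\<close> is an admissible test function, so
the equation evaluated at \<open>u\<close> is nonpositive there, whereas strict monotonicity in the value
makes it larger than the equation evaluated at \<open>\<phi>\<close>, which is nonnegative.  The compact set \<open>K\<close>
guarantees that a maximum exists: outside its part in \<open>\<Omega>\<close> the order is already known.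
\<close>

lemma viscosity_subsolution_le:
  fixes u \<phi> :: "'a::real_inner \<Rightarrow> real"
  assumes sub: "viscosity_subsolution \<Omega> E u" and test: "C1_test \<Omega> \<phi> D"
    and mono: "\<And>z r s. z \<in> \<Omega> \<Longrightarrow> r < s \<Longrightarrow> E z r (D z) < E z s (D z)"
    and super: "\<And>z. z \<in> \<Omega> \<Longrightarrow> E z (\<phi> z) (D z) \<ge> 0"
    and K: "compact K" "continuous_on K u" "continuous_on K \<phi>"
    and Q: "\<Omega> \<subseteq> Q"
    and out: "\<And>z. z \<in> Q \<Longrightarrow> z \<notin> K \<inter> \<Omega> \<Longrightarrow> u z \<le> \<phi> z"
    and "K \<subseteq> Q" "w \<in> Q"
  shows "u w \<le> \<phi> w"
proof (rule ccontr)
  assume "\<not> u w \<le> \<phi> w"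
  hence w: "u w - \<phi> w > 0" by simp
  hence "w \<in> K" using out[OF \<open>w \<in> Q\<close>] by auto
  obtain z where z: "z \<in> K" "\<And>y. y \<in> K \<Longrightarrow> u y - \<phi> y \<le> u z - \<phi> z"
    using continuous_attains_sup[of K "\<lambda>y. u y - \<phi> y"] K \<open>w \<in> K\<close>
    by (auto intro: continuous_on_diff)
  have pos: "u z - \<phi> z > 0" using z(2)[OF \<open>w \<in> K\<close>] w by simp
  hence "z \<in> \<Omega>" using out[of z] z(1) \<open>K \<subseteq> Q\<close> by fastforce
  have "u y - \<phi> y \<le> u z - \<phi> z" if "y \<in> \<Omega>" for y
    using z(2)[of y] out[of y] pos that Q by fastforce
  hence "\<forall>\<^sub>F y in at z within \<Omega>. u y - \<phi> y \<le> u z - \<phi> z"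
    by (simp add: eventually_at_filter)
  with sub test \<open>z \<in> \<Omega>\<close> have "E z (u z) (D z) \<le> 0"
    unfolding viscosity_subsolution_def by blast
  with mono[OF \<open>z \<in> \<Omega>\<close>, of "\<phi> z" "u z"] super[OF \<open>z \<in> \<Omega>\<close>] pos show False
    by simp
qed

lemma C1_test_minus: "C1_test \<Omega> \<phi> D \<Longrightarrow> C1_test \<Omega> (\<lambda>z. - \<phi> z) (\<lambda>z. - D z)"
  unfolding C1_test_def by (auto intro: continuous_on_minus GDERIV_minus)

lemma C1_test_add:
  "C1_test \<Omega> f Df \<Longrightarrow> C1_test \<Omega> g Dg \<Longrightarrow> C1_test \<Omega> (\<lambda>z. f z + g z) (\<lambda>z. Df z + Dg z)"
  unfolding C1_test_def by (auto intro: continuous_on_add GDERIV_add)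

lemma viscosity_subsolution_minus:
  assumes "viscosity_supersolution \<Omega> E u"
  shows "viscosity_subsolution \<Omega> (\<lambda>z r p. - E z (- r) (- p)) (\<lambda>z. - u z)"
  unfolding viscosity_subsolution_def
proof (intro allI ballI impI)
  fix \<phi> D z
  assume z: "z \<in> \<Omega>" and test: "C1_test \<Omega> \<phi> D"
    and max: "\<forall>\<^sub>F y in at z within \<Omega>. - u y - \<phi> y \<le> - u z - \<phi> z"
  have "\<forall>\<^sub>F y in at z within \<Omega>. u y - (- \<phi> y) \<ge> u z - (- \<phi> z)"
    using max by eventually_elim simp
  with assms z C1_test_minus[OF test] have "E z (u z) (- D z) \<ge> 0"
    unfolding viscosity_supersolution_def by blast
  thus "- E z (- (- u z)) (- D z) \<le> 0" by simp
qed

lemma viscosity_supersolution_ge: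
  fixes u \<phi> :: "'a::real_inner \<Rightarrow> real"
  assumes super: "viscosity_supersolution \<Omega> E u" and test: "C1_test \<Omega> \<phi> D"
    and mono: "\<And>z r s. z \<in> \<Omega> \<Longrightarrow> r < s \<Longrightarrow> E z r (D z) < E z s (D z)"
    and sub: "\<And>z. z \<in> \<Omega> \<Longrightarrow> E z (\<phi> z) (D z) \<le> 0"
    and K: "compact K" "continuous_on K u" "continuous_on K \<phi>"
    and Q: "\<Omega> \<subseteq> Q"
    and out: "\<And>z. z \<in> Q \<Longrightarrow> z \<notin> K \<inter> \<Omega> \<Longrightarrow> \<phi> z \<le> u z"
    and "K \<subseteq> Q" "w \<in> Q"
  shows "\<phi> w \<le> u w"
proof -
  have "- u w \<le> - \<phi> w"
    by (rule viscosity_subsolution_le[OF viscosity_subsolution_minus[OF super]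
          C1_test_minus[OF test], where K = K and Q = Q])
       (use assms in \<open>auto intro: continuous_on_minus\<close>)
  thus ?thesis by simp
qed

section \<open>Barriers for the equation\<close>

text \<open>
All barriers below are sums of functions of a single linear combination of \<open>x\<close> and \<open>t\<close>.
\<close>

lemma C1_test_plane_wave:
  fixes \<Omega> :: "(real \<times> real) set"
  assumes "\<And>z. z \<in> \<Omega> \<Longrightarrow>
      (g has_real_derivative g' (a * fst z + b * snd z)) (at (a * fst z + b * snd z))"
    and "continuous_on \<Omega> (\<lambda>z. g' (a * fst z + b * snd z))"
  shows "C1_test \<Omega> (\<lambda>z. g (a * fst z + b * snd z)) (\<lambda>z. g' (a * fst z + b * snd z) *\<^sub>R (a, b))"
  unfolding C1_test_def
proof (intro conjI ballI)
  show "continuous_on \<Omega> (\<lambda>z. g' (a * fst z + b * snd z) *\<^sub>R (a, b))"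
    using assms(2) by (intro continuous_intros)
  fix z assume "z \<in> \<Omega>"
  have "GDERIV (\<lambda>z. a * fst z + b * snd z) z :> (a, b)"
    unfolding gderiv_def
    by (auto intro!: derivative_eq_intros simp: inner_prod_def algebra_simps)
  from GDERIV_DERIV_compose[OF this assms(1)[OF \<open>z \<in> \<Omega>\<close>]]
  show "GDERIV (\<lambda>z. g (a * fst z + b * snd z)) z :> g' (a * fst z + b * snd z) *\<^sub>R (a, b)" .
qed

lemma CF_equation_strict_mono:
  assumes "z \<in> {0<..} \<times> {0<..}" "r < s"
  shows "CF_equation z r p < CF_equation z s p"
  using assms by (auto simp: CF_equation_def divide_strict_right_mono split: prod.splits)

lemma CF_equation_eq:
  "CF_equation (x, t) r (p, q) = q + p * (p - 3) / 2 + r / x"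
  by (simp add: CF_equation_def algebra_simps add_divide_distrib diff_divide_distrib)

text \<open>
Here \<open>r\<close> and \<open>p\<close> are value and slope of a steady solution, \<open>a / k\<close> is the value of the wave
\<open>exp (- k (x + t/2)) / k\<close> (so its gradient is \<open>(- a, - a/2)\<close>), and \<open>w\<close> is the value of a
penalization \<open>\<eta> exp (x + 3 t)\<close> (with gradient \<open>(w, 3 w)\<close>).  The wave speed \<open>-1/2\<close> is the slowest
characteristic speed, attained at slope 1, which leaves the nonnegative factor \<open>1 - p\<close> at \<open>a\<close>;
the speed 3 of the penalization outweighs all cross terms because \<open>a \<le> 1\<close>.
\<close>

lemma upper_barrier_supersolution:
  assumes "x > 0" "p \<le> 1" "0 \<le> p" "r / x = p * (3 - p) / 2" "0 \<le> a" "a \<le> 1" "0 \<le> w" "k > 0"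
  shows "0 \<le> CF_equation (x, t) (r + a / k + w) (p - a + w, 3 * w - a / 2)"
proof -
  have "CF_equation (x, t) (r + a / k + w) (p - a + w, 3 * w - a / 2)
      = a * (1 - p + a / 2) + w * (3/2 + p + w / 2 - a) + (a / k + w) / x"
    unfolding CF_equation_eq add_divide_distrib assms(4) by (simp add: field_simps)
  also have "\<dots> \<ge> 0"
    using assms by (intro add_nonneg_nonneg mult_nonneg_nonneg divide_nonneg_nonneg) auto
  finally show ?thesis .
qed

text \<open>
Subtracting the wave raises the slope above \<open>p\<close>, and near \<open>x = 0\<close>, where \<open>p\<close> is close to 1, the
characteristics may move left more slowly than the wave does.  There the zeroth-order term
\<open>a / (k x)\<close> compensates; it stays effective up to \<open>x = 2 / k\<close>, beyond which \<open>p \<le> 1/2\<close> leaves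
enough room.  The value \<open>w\<close> belongs to the penalization \<open>\<eta> (x + 2 t)\<close>, whose slope \<open>\<eta>\<close> has to
stay bounded because the quadratic term of \<open>H\<close> now has the unfavourable sign.
\<close>

lemma lower_barrier_subsolution:
  assumes "x > 0" "p \<le> 1" "0 \<le> p" "r / x = p * (3 - p) / 2" "0 \<le> a" "a \<le> 1" "0 \<le> w" "k > 0"
    and "0 \<le> \<eta>" "\<eta> \<le> 1" and slope: "k * x \<ge> 2 \<Longrightarrow> p \<le> 1/2"
  shows "CF_equation (x, t) (r - a / k - w) (p + a - \<eta>, a / 2 - 2 * \<eta>) \<le> 0"
proof -
  have eq: "CF_equation (x, t) (r - a / k - w) (p + a - \<eta>, a / 2 - 2 * \<eta>)
      = - (a * (1 - p - a / 2 + 1 / (k * x)) + \<eta> * (1/2 + p + a - \<eta> / 2) + w / x)"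
    unfolding CF_equation_eq diff_divide_distrib assms(4) by (simp add: field_simps)
  have first: "1 - p - a / 2 + 1 / (k * x) \<ge> 0"
  proof (cases "k * x \<ge> 2")
    case True
    then show ?thesis using slope assms by (simp add: add_nonneg_nonneg)
  next
    case False
    hence "1 / (k * x) \<ge> 1 / 2" using assms by (intro divide_left_mono) auto
    then show ?thesis using assms by linarith
  qed
  have "0 \<le> a * (1 - p - a / 2 + 1 / (k * x)) + \<eta> * (1/2 + p + a - \<eta> / 2) + w / x"
    using assms by (intro add_nonneg_nonneg mult_nonneg_nonneg[OF _ first]
        mult_nonneg_nonneg[of \<eta>] divide_nonneg_nonneg) auto
  with eq show ?thesis by simp
qed

lemma rescaled_profile_test:
  assumes "\<kappa> > 0"
  shows "C1_test ({0<..} \<times> {0<..}) (\<lambda>z. profile (\<kappa> * fst z + 0 * snd z) / \<kappa>)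
           (\<lambda>z. (profile_slope (\<kappa> * fst z + 0 * snd z) / \<kappa>) *\<^sub>R (\<kappa>, 0))"
proof (rule C1_test_plane_wave)
  show "((\<lambda>y. profile y / \<kappa>) has_real_derivative profile_slope (\<kappa> * fst z + 0 * snd z) / \<kappa>)
      (at (\<kappa> * fst z + 0 * snd z))" if "z \<in> {0<..} \<times> {0<..}" for z :: "real \<times> real"
    using that assms by (intro DERIV_cdivide has_real_derivative_profile) auto
  show "continuous_on ({0<..} \<times> {0<..}) (\<lambda>z. profile_slope (\<kappa> * fst z + 0 * snd z) / \<kappa>)"
    using assms
    by (intro continuous_intros continuous_on_compose2[OF continuous_on_profile_slope]) auto
qed

lemma continuous_on_rescaled_profile:
  assumes "\<kappa> > 0"
  shows "continuous_on ({0..} \<times> {0..}) (\<lambda>z::real \<times> real. profile (\<kappa> * fst z))"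
  using assms
  by (intro continuous_intros continuous_on_compose2[OF continuous_on_profile]) auto

lemma rescaled_profile_le: "\<kappa> > 0 \<Longrightarrow> x \<ge> 0 \<Longrightarrow> profile (\<kappa> * x) / \<kappa> \<le> x"
  using profile_diff_le(2)[of 0 "\<kappa> * x"] by (simp add: field_simps)

lemma rescaled_profile_steady:
  "\<kappa> > 0 \<Longrightarrow> x > 0 \<Longrightarrow>
    profile (\<kappa> * x) / \<kappa> / x = profile_slope (\<kappa> * x) * (3 - profile_slope (\<kappa> * x)) / 2"
  using profile_steady[of "\<kappa> * x"] by simp

text \<open>
The choice \<open>k = 1 / (3 R)\<close> lets the wave \<open>exp (- k x) / k\<close>, although its slope for \<open>x \<ge> 0\<close> never
exceeds 1 in modulus, cover the a priori bound \<open>x\<close> on the whole interval from 0 to \<open>R\<close>.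
\<close>

lemma exp_dominates_id:
  fixes R x :: real
  assumes "R > 0" "0 \<le> x" "x \<le> R"
  shows "x \<le> exp (- (1 / (3 * R) * x)) / (1 / (3 * R))"
proof -
  have "2/3 \<le> 1 - x / (3 * R)" using assms by (simp add: field_simps)
  also have "\<dots> \<le> exp (- (x / (3 * R)))"
    using exp_ge_add_one_self[of "- (x / (3 * R))"] by simp
  finally have "2/3 * (3 * R) \<le> exp (- (x / (3 * R))) * (3 * R)"
    using assms by (intro mult_right_mono) auto
  moreover have "x \<le> 2/3 * (3 * R)" using assms by simp
  ultimately show ?thesis by simp
qed

section \<open>Bounds by rescaled profiles\<close>

lemma CF_solution_le_profile:
  assumes F: "CF_solution F0 F" and \<kappa>: "\<kappa> > 0"
    and far: "\<forall>\<^sub>F x in at_top. F0 x \<le> profile (\<kappa> * x) / \<kappa>"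
  obtains k where "k > 0"
    "\<And>x t. x \<ge> 0 \<Longrightarrow> t \<ge> 0 \<Longrightarrow> F (x, t) \<le> profile (\<kappa> * x) / \<kappa> + exp (- (k * x + k / 2 * t)) / k"
proof -
  let ?Q = "{0..} \<times> {0..} :: (real \<times> real) set"
  let ?\<Omega> = "{0<..} \<times> {0<..} :: (real \<times> real) set"
  from F have cont: "continuous_on ?Q F" and sub: "viscosity_subsolution ?\<Omega> CF_equation F"
    and F_le: "\<And>x t. x \<ge> 0 \<Longrightarrow> t \<ge> 0 \<Longrightarrow> F (x, t) \<le> x"
    and F_init: "\<And>x. x \<ge> 0 \<Longrightarrow> F (x, 0) = F0 x"
    by (auto simp: CF_solution_def viscosity_solution_def)
  obtain R where R: "R > 0" "\<And>x. x \<ge> R \<Longrightarrow> F0 x \<le> profile (\<kappa> * x) / \<kappa>"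
  proof -
    from far obtain R0 where "\<And>x. x \<ge> R0 \<Longrightarrow> F0 x \<le> profile (\<kappa> * x) / \<kappa>"
      by (auto simp: eventually_at_top_linorder)
    thus ?thesis by (intro that[of "max R0 1"]) auto
  qed
  define k where "k = 1 / (3 * R)"
  have k: "k > 0" using R by (simp add: k_def)
  have prof0: "profile (\<kappa> * x) / \<kappa> \<ge> 0" for x using \<kappa> by (simp add: profile_nonneg)
  have init: "F0 x \<le> profile (\<kappa> * x) / \<kappa> + exp (- (k * x)) / k" if "x \<ge> 0" for x
  proof (cases "x \<ge> R")
    case True
    have "0 \<le> exp (- (k * x)) / k" using k by simp
    with R(2)[OF True] show ?thesis by linarith
  next
    case False
    with exp_dominates_id[OF R(1) that] F_le[OF that, of 0] F_init[OF that] prof0[of x]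
    show ?thesis unfolding k_def by linarith
  qed
  have perturbed: "F (x, t) \<le> profile (\<kappa> * x) / \<kappa> + exp (- (k * x + k / 2 * t)) / k + \<eta> * exp (x + 3 * t)"
    if xt: "x \<ge> 0" "t \<ge> 0" and \<eta>: "\<eta> > 0" for x t \<eta>
  proof -
    define U where "U z = profile (\<kappa> * fst z + 0 * snd z) / \<kappa>
      + exp (- (k * fst z + k / 2 * snd z)) / k + \<eta> * exp (1 * fst z + 3 * snd z)" for z
    define DU where "DU z = (profile_slope (\<kappa> * fst z + 0 * snd z) / \<kappa>) *\<^sub>R (\<kappa>, 0)
      + (- exp (- (k * fst z + k / 2 * snd z)) / k) *\<^sub>R (k, k / 2)
      + (\<eta> * exp (1 * fst z + 3 * snd z)) *\<^sub>R (1, 3)" for z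
    have test: "C1_test ?\<Omega> U DU"
      unfolding U_def DU_def
      using k
      by (intro C1_test_add rescaled_profile_test[OF \<kappa>]
            C1_test_plane_wave[where g = "\<lambda>y. exp (- y) / k"]
            C1_test_plane_wave[where g = "\<lambda>y. \<eta> * exp y"])
         (auto intro!: derivative_eq_intros continuous_intros)
    have "\<forall>\<^sub>F y in at_top. y \<le> \<eta> * exp y" using \<eta> by real_asymp
    then obtain B0 where B0: "\<And>y. y \<ge> B0 \<Longrightarrow> y \<le> \<eta> * exp y"
      by (auto simp: eventually_at_top_linorder)
    \<comment> \<open>Since \<open>x \<le> x + 3 t\<close>, the penalization alone dominates \<open>F\<close> once \<open>x\<close> or \<open>t\<close> exceeds \<open>B0\<close>.\<close>
    define B where "B = max B0 0"
    have U_ge: "U (x, t) \<ge> \<eta> * exp (x + 3 * t)" for x t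
      using prof0[of x] k by (simp add: U_def add_nonneg_nonneg)
    have "F (x, t) \<le> U (x, t)"
    proof (rule viscosity_subsolution_le[OF sub test, where K = "{0..B} \<times> {0..B}" and Q = ?Q])
      show "0 \<le> CF_equation z (U z) (DU z)" if in_\<Omega>: "z \<in> ?\<Omega>" for z
      proof -
        obtain x t where z: "z = (x, t)" "x > 0" "t > 0" using in_\<Omega> by auto
        have "0 \<le> k * x + k / 2 * t" using z k by (intro add_nonneg_nonneg) auto
        hence exp_le_1: "exp (- (k * x + k / 2 * t)) \<le> 1" by simp
        have "0 \<le> CF_equation (x, t)
          (profile (\<kappa> * x) / \<kappa> + exp (- (k * x + k / 2 * t)) / k + \<eta> * exp (x + 3 * t))
          (profile_slope (\<kappa> * x) - exp (- (k * x + k / 2 * t)) + \<eta> * exp (x + 3 * t),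
           3 * (\<eta> * exp (x + 3 * t)) - exp (- (k * x + k / 2 * t)) / 2)"
          using z k \<eta> \<kappa> profile_slope_bounds[of "\<kappa> * x"] rescaled_profile_steady[OF \<kappa>, of x]
            exp_le_1
          by (intro upper_barrier_supersolution) (auto simp: less_imp_le)
        then show ?thesis using \<kappa> k by (simp add: z(1) U_def DU_def mult.commute)
      qed
      show "F z \<le> U z" if outside: "z \<in> ?Q" "z \<notin> {0..B} \<times> {0..B} \<inter> ?\<Omega>" for z
      proof -
        obtain x t where z: "z = (x, t)" "x \<ge> 0" "t \<ge> 0" using outside by auto
        consider "x = 0" | "t = 0" | "x + 3 * t \<ge> B0"
          using outside z by (fastforce simp: B_def)
        then show ?thesis
        proof cases
          case 1
          have "F z \<le> 0" using F_le[of 0 t] z 1 by simp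
          also have "0 \<le> \<eta> * exp (x + 3 * t)" using \<eta> by simp
          finally show ?thesis using U_ge[of x t] z by simp
        next
          case 2
          have "0 \<le> \<eta> * exp x" using \<eta> by simp
          then show ?thesis
            using init[OF z(2)] z F_init[OF z(2)] by (simp add: U_def 2)
        next
          case 3
          then show ?thesis using B0[OF 3] U_ge[of x t] F_le[of x t] z by simp
        qed
      qed
      show "continuous_on ({0..B} \<times> {0..B}) U"
      proof (rule continuous_on_subset)
        show "continuous_on ?Q U"
          unfolding U_def mult_zero_left add_0_right using \<kappa> k
          by (intro continuous_intros continuous_on_rescaled_profile) auto
      qed auto
      show "continuous_on ({0..B} \<times> {0..B}) F"
        by (rule continuous_on_subset[OF cont]) auto
    qed (use xt in \<open>auto intro: CF_equation_strict_mono compact_Times\<close>)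
    then show ?thesis by (simp add: U_def)
  qed
  show ?thesis
  proof (rule that[OF k])
    fix x t :: real assume xt: "x \<ge> 0" "t \<ge> 0"
    show "F (x, t) \<le> profile (\<kappa> * x) / \<kappa> + exp (- (k * x + k / 2 * t)) / k"
    proof (rule field_le_epsilon)
      fix e :: real assume "e > 0"
      with perturbed[OF xt, of "e / exp (x + 3 * t)"]
      show "F (x, t) \<le> profile (\<kappa> * x) / \<kappa> + exp (- (k * x + k / 2 * t)) / k + e"
        by simp
    qed
  qed
qed

lemma rescaled_profile_sublinear:
  assumes \<kappa>: "\<kappa> > 0" and \<eta>: "\<eta> > 0"
  shows "\<forall>\<^sub>F x in at_top. profile (\<kappa> * x) / \<kappa> \<le> \<eta> * x"
proof -
  have scale: "filterlim (\<lambda>x. \<kappa> * x) at_top at_top"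
    using \<kappa> by real_asymp
  have "((\<lambda>x. profile_slope (\<kappa> * x) * (3 - profile_slope (\<kappa> * x)) / 2) \<longlongrightarrow> 0 * (3 - 0) / 2) at_top"
    by (intro tendsto_intros filterlim_compose[OF profile_slope_tendsto_0 scale]) auto
  hence "\<forall>\<^sub>F x in at_top. profile_slope (\<kappa> * x) * (3 - profile_slope (\<kappa> * x)) / 2 < \<eta>"
    using \<eta> by (intro order_tendstoD(2)) simp_all
  with eventually_gt_at_top[of 0] show ?thesis
  proof eventually_elim
    case (elim x)
    then have "profile (\<kappa> * x) / \<kappa> / x < \<eta>"
      using rescaled_profile_steady[OF \<kappa>, of x] by linarith
    then show ?case
      using pos_divide_less_eq[OF elim(1), of "profile (\<kappa> * x) / \<kappa>" \<eta>] by linarith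
  qed
qed

lemma CF_solution_ge_profile:
  assumes F: "CF_solution F0 F" and \<kappa>: "\<kappa> > 0"
    and far: "\<forall>\<^sub>F x in at_top. profile (\<kappa> * x) / \<kappa> \<le> F0 x"
  obtains k where "k > 0"
    "\<And>x t. x \<ge> 0 \<Longrightarrow> t \<ge> 0 \<Longrightarrow> profile (\<kappa> * x) / \<kappa> - exp (- (k * x + k / 2 * t)) / k \<le> F (x, t)"
proof -
  let ?Q = "{0..} \<times> {0..} :: (real \<times> real) set"
  let ?\<Omega> = "{0<..} \<times> {0<..} :: (real \<times> real) set"
  from F have cont: "continuous_on ?Q F" and super: "viscosity_supersolution ?\<Omega> CF_equation F"
    and F_ge: "\<And>x t. x \<ge> 0 \<Longrightarrow> t \<ge> 0 \<Longrightarrow> 0 \<le> F (x, t)"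
    and F_init: "\<And>x. x \<ge> 0 \<Longrightarrow> F (x, 0) = F0 x"
    by (auto simp: CF_solution_def viscosity_solution_def)
  obtain R where R: "R > 0" "\<And>x. x \<ge> R \<Longrightarrow> profile (\<kappa> * x) / \<kappa> \<le> F0 x"
    "\<And>x. x \<ge> R \<Longrightarrow> profile_slope (\<kappa> * x) \<le> 1/2"
  proof -
    have "filterlim (\<lambda>x. \<kappa> * x) at_top at_top"
      using \<kappa> by real_asymp
    from filterlim_compose[OF profile_slope_tendsto_0 this]
    have "\<forall>\<^sub>F x in at_top. profile_slope (\<kappa> * x) < 1/2"
      by (rule order_tendstoD) simp
    with far have "\<forall>\<^sub>F x in at_top. profile (\<kappa> * x) / \<kappa> \<le> F0 x \<and> profile_slope (\<kappa> * x) < 1/2"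
      by eventually_elim simp
    then obtain R0 where
      "\<And>x. x \<ge> R0 \<Longrightarrow> profile (\<kappa> * x) / \<kappa> \<le> F0 x \<and> profile_slope (\<kappa> * x) < 1/2"
      by (auto simp: eventually_at_top_linorder)
    thus ?thesis by (intro that[of "max R0 1"]) (auto simp: less_imp_le)
  qed
  define k where "k = 1 / (3 * R)"
  have k: "k > 0" using R by (simp add: k_def)
  have slope: "profile_slope (\<kappa> * x) \<le> 1/2" if "k * x \<ge> 2" for x
    using that R(1) by (intro R(3)) (simp add: k_def field_simps)
  have init: "profile (\<kappa> * x) / \<kappa> - exp (- (k * x)) / k \<le> F0 x" if "x \<ge> 0" for x
  proof (cases "x \<ge> R")
    case True
    have "0 \<le> exp (- (k * x)) / k" using k by simp
    with R(2)[OF True] show ?thesis by linarith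
  next
    case False
    with exp_dominates_id[OF R(1) that] F_ge[OF that, of 0] F_init[OF that]
      rescaled_profile_le[OF \<kappa> that]
    show ?thesis unfolding k_def by linarith
  qed
  have perturbed: "profile (\<kappa> * x) / \<kappa> - exp (- (k * x + k / 2 * t)) / k - \<eta> * (x + 2 * t) \<le> F (x, t)"
    if xt: "x \<ge> 0" "t \<ge> 0" and \<eta>: "\<eta> > 0" "\<eta> \<le> 1" for x t \<eta>
  proof -
    define V where "V z = profile (\<kappa> * fst z + 0 * snd z) / \<kappa>
      + - exp (- (k * fst z + k / 2 * snd z)) / k + - \<eta> * (1 * fst z + 2 * snd z)" for z
    define DV where "DV z = (profile_slope (\<kappa> * fst z + 0 * snd z) / \<kappa>) *\<^sub>R (\<kappa>, 0)
      + (exp (- (k * fst z + k / 2 * snd z)) / k) *\<^sub>R (k, k / 2)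
      + (- \<eta>) *\<^sub>R (1, 2)" for z :: "real \<times> real"
    have test: "C1_test ?\<Omega> V DV"
      unfolding V_def DV_def
      using k
      by (intro C1_test_add rescaled_profile_test[OF \<kappa>]
            C1_test_plane_wave[where g = "\<lambda>y. - exp (- y) / k"]
            C1_test_plane_wave[where g = "\<lambda>y. - \<eta> * y"])
         (auto intro!: derivative_eq_intros continuous_intros)
    from rescaled_profile_sublinear[OF \<kappa> \<eta>(1)]
    obtain B0 where B0: "\<And>x. x \<ge> B0 \<Longrightarrow> profile (\<kappa> * x) / \<kappa> \<le> \<eta> * x"
      by (auto simp: eventually_at_top_linorder)
    \<comment> \<open>For \<open>x \<ge> B0\<close> the term \<open>\<eta> x\<close> beats the profile; for smaller \<open>x\<close> the profile is at most \<open>B0\<close>,\<close>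
    \<comment> \<open>and \<open>2 \<eta> t\<close> reaches that value at \<open>t = B0 / (2 \<eta>)\<close>.\<close>
    define B where "B = max (max B0 0) (B0 / (2 * \<eta>))"
    have V_le: "V (x, t) \<le> profile (\<kappa> * x) / \<kappa> - \<eta> * (x + 2 * t)" for x t
      using k by (simp add: V_def)
    have "V (x, t) \<le> F (x, t)"
    proof (rule viscosity_supersolution_ge[OF super test, where K = "{0..B} \<times> {0..B}" and Q = ?Q])
      show "CF_equation z (V z) (DV z) \<le> 0" if in_\<Omega>: "z \<in> ?\<Omega>" for z
      proof -
        obtain x t where z: "z = (x, t)" "x > 0" "t > 0" using in_\<Omega> by auto
        have "0 \<le> k * x + k / 2 * t" using z k by (intro add_nonneg_nonneg) auto
        hence exp_le_1: "exp (- (k * x + k / 2 * t)) \<le> 1" by simp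
        have "CF_equation (x, t)
          (profile (\<kappa> * x) / \<kappa> - exp (- (k * x + k / 2 * t)) / k - \<eta> * (x + 2 * t))
          (profile_slope (\<kappa> * x) + exp (- (k * x + k / 2 * t)) - \<eta>,
           exp (- (k * x + k / 2 * t)) / 2 - 2 * \<eta>) \<le> 0"
          using z k \<eta> \<kappa> profile_slope_bounds[of "\<kappa> * x"] rescaled_profile_steady[OF \<kappa>, of x]
            slope[of x] exp_le_1
          by (intro lower_barrier_subsolution) (auto simp: less_imp_le)
        then show ?thesis using \<kappa> k by (simp add: z(1) V_def DV_def mult.commute)
      qed
      show "V z \<le> F z" if outside: "z \<in> ?Q" "z \<notin> {0..B} \<times> {0..B} \<inter> ?\<Omega>" for z
      proof -
        obtain x t where z: "z = (x, t)" "x \<ge> 0" "t \<ge> 0" using outside by auto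
        have "\<eta> * t \<ge> 0" "\<eta> * x \<ge> 0" using \<eta> z by auto
        consider "x = 0" | "t = 0" | "x \<ge> B0" | "x < B0" "t \<ge> B0 / (2 * \<eta>)"
          using outside z by (fastforce simp: B_def)
        then show ?thesis
        proof cases
          case 1
          then show ?thesis
            using F_ge[of x t] V_le[of x t] z \<open>\<eta> * t \<ge> 0\<close> by simp
        next
          case 2
          then show ?thesis
            using init[OF z(2)] z F_init[OF z(2)] \<open>\<eta> * x \<ge> 0\<close> by (simp add: V_def)
        next
          case 3
          then show ?thesis
            using B0[OF 3] V_le[of x t] F_ge[of x t] z \<open>\<eta> * t \<ge> 0\<close>
            by (simp add: algebra_simps)
        next
          case 4
          hence "B0 \<le> \<eta> * (2 * t)" using \<eta> by (simp add: field_simps)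
          then show ?thesis
            using 4 rescaled_profile_le[OF \<kappa> z(2)] V_le[of x t] F_ge[of x t] z \<open>\<eta> * x \<ge> 0\<close>
            by (simp add: algebra_simps)
        qed
      qed
      show "continuous_on ({0..B} \<times> {0..B}) V"
      proof (rule continuous_on_subset)
        show "continuous_on ?Q V"
          unfolding V_def mult_zero_left add_0_right using \<kappa> k
          by (intro continuous_intros continuous_on_rescaled_profile) auto
      qed auto
      show "continuous_on ({0..B} \<times> {0..B}) F"
        by (rule continuous_on_subset[OF cont]) auto
    qed (use xt in \<open>auto intro: CF_equation_strict_mono compact_Times\<close>)
    then show ?thesis by (simp add: V_def algebra_simps)
  qed
  show ?thesis
  proof (rule that[OF k])
    fix x t :: real assume xt: "x \<ge> 0" "t \<ge> 0"
    show "profile (\<kappa> * x) / \<kappa> - exp (- (k * x + k / 2 * t)) / k \<le> F (x, t)"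
    proof (rule field_le_epsilon)
      fix e :: real assume "e > 0"
      define \<eta> where "\<eta> = min 1 (e / (1 + x + 2 * t))"
      have pos: "1 + x + 2 * t > 0" using xt by simp
      have \<eta>: "\<eta> > 0" "\<eta> \<le> 1" using \<open>e > 0\<close> pos by (auto simp: \<eta>_def)
      have "\<eta> * (x + 2 * t) \<le> e / (1 + x + 2 * t) * (1 + x + 2 * t)"
        using xt \<open>e > 0\<close> pos by (intro mult_mono) (auto simp: \<eta>_def)
      also have "\<dots> = e" using pos by simp
      finally show "profile (\<kappa> * x) / \<kappa> - exp (- (k * x + k / 2 * t)) / k \<le> F (x, t) + e"
        using perturbed[OF xt \<eta>] by simp
    qed
  qed
qed

section \<open>Matching the growth of the initial datum\<close>

lemma rescaled_profile_asymptotics: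
  assumes "\<kappa> > 0"
  shows "((\<lambda>x. profile (\<kappa> * x) / \<kappa> / x powr (2/3)) \<longlongrightarrow> 3/2 * \<kappa> powr (- 1/3)) at_top"
proof -
  have "filterlim (\<lambda>x. \<kappa> * x) at_top at_top"
    using assms by real_asymp
  from filterlim_compose[OF profile_asymptotics this]
  have lim: "((\<lambda>x. profile (\<kappa> * x) / (\<kappa> * x) powr (2/3) * \<kappa> powr (- 1/3))
      \<longlongrightarrow> 3/2 * \<kappa> powr (- 1/3)) at_top"
    by (rule tendsto_mult_right)
  have \<kappa>: "\<kappa> powr (2/3) = \<kappa> * \<kappa> powr (- 1/3)"
    using powr_add[of \<kappa> 1 "- 1/3"] assms by simp
  show ?thesis
  proof (rule Lim_transform_eventually[OF lim])
    show "\<forall>\<^sub>F x in at_top. profile (\<kappa> * x) / (\<kappa> * x) powr (2/3) * \<kappa> powr (- 1/3)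
        = profile (\<kappa> * x) / \<kappa> / x powr (2/3)"
      using eventually_gt_at_top[of 0]
      by eventually_elim (use assms in \<open>simp add: powr_mult \<kappa>\<close>)
  qed
qed

lemma eventually_le_of_ratio_limits:
  fixes f g h :: "real \<Rightarrow> real"
  assumes "((\<lambda>x. f x / h x) \<longlongrightarrow> a) G" "((\<lambda>x. g x / h x) \<longlongrightarrow> b) G" "a < b"
    and "\<forall>\<^sub>F x in G. h x > 0"
  shows "\<forall>\<^sub>F x in G. f x \<le> g x"
proof -
  from \<open>a < b\<close> obtain m where "a < m" "m < b" using dense by blast
  with assms(1,2) have "\<forall>\<^sub>F x in G. f x / h x < m" "\<forall>\<^sub>F x in G. m < g x / h x"
    by (auto dest: order_tendstoD)
  with assms(4) show ?thesis
  proof eventually_elim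
    case (elim x)
    then have "f x / h x < g x / h x" by simp
    with elim(1) show ?case by (simp add: divide_less_cancel)
  qed
qed

lemma rescaled_profile_dist:
  assumes "a > 0" "c > 0" "x \<ge> 0"
  shows "\<bar>profile (a * x) / a - profile (c * x) / c\<bar> \<le> 2 * \<bar>a - c\<bar> / c * x"
proof -
  have "\<bar>profile (a * x) - profile (c * x)\<bar> \<le> \<bar>a * x - c * x\<bar>"
    using profile_diff_le[of "a * x" "c * x"] profile_diff_le[of "c * x" "a * x"] assms
    by (smt (verit) mult_nonneg_nonneg)
  also have "\<dots> = \<bar>a - c\<bar> * x"
    using assms by (simp add: abs_mult flip: left_diff_distrib)
  finally have 1: "\<bar>(profile (a * x) - profile (c * x)) / c\<bar> \<le> \<bar>a - c\<bar> / c * x"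
    using assms by (simp add: divide_right_mono)
  have "\<bar>profile (a * x) / a * ((c - a) / c)\<bar> = profile (a * x) / a * (\<bar>a - c\<bar> / c)"
    using assms by (simp add: abs_mult abs_divide profile_nonneg abs_minus_commute)
  also have "\<dots> \<le> x * (\<bar>a - c\<bar> / c)"
    using assms rescaled_profile_le[of a x] by (intro mult_right_mono) auto
  finally have 2: "\<bar>profile (a * x) / a * ((c - a) / c)\<bar> \<le> \<bar>a - c\<bar> / c * x"
    by (simp add: mult.commute)
  have "profile (a * x) / a - profile (c * x) / c
      = (profile (a * x) - profile (c * x)) / c + profile (a * x) / a * ((c - a) / c)"
    using assms by (simp add: field_simps)
  with 1 2 show ?thesis by linarith
qed

section \<open>Convergence to the profile\<close>

theorem theorem1p4:
  fixes F0 Fbar :: "real \<Rightarrow> real" and F :: "real \<times> real \<Rightarrow> real" and \<delta> c x0 :: real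
  assumes "\<exists>L. L-lipschitz_on {0..} F0"
    and "\<forall>x\<ge>0. 0 \<le> F0 x \<and> F0 x \<le> x"
    and "sublinear F0"
    and "AE x in lebesgue. 0 \<le> x \<longrightarrow>
           (\<exists>d. (F0 has_real_derivative d) (at x within {0..}) \<and> 0 \<le> d \<and> d \<le> 1)"
    and "\<delta> > 0"
    and "((\<lambda>x. F0 x / x powr (2/3)) \<longlongrightarrow> \<delta>) at_top"
    and "CF_solution F0 F"
    and "c = 27 / (8 * \<delta> ^ 3)"
    and "x0 = 4 / 27"
    and "continuous_on {0..} Fbar"
    and "Fbar 0 = 0"
    and "\<forall>x>0. (Fbar has_real_derivative
           1 / sqrt x * (((sqrt (x + x0) + sqrt x) / 2) powr (1/3)
                         - ((sqrt (x + x0) - sqrt x) / 2) powr (1/3))) (at x)"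
  shows "\<forall>K. compact K \<and> K \<subseteq> {0..} \<longrightarrow>
           uniform_limit K (\<lambda>t x. F (x, t)) (\<lambda>x. 1 / c * Fbar (c * x)) at_top"
proof (intro allI impI, elim conjE)
  fix K :: "real set" assume K: "compact K" "K \<subseteq> {0..}"
  have c: "c > 0" using \<open>\<delta> > 0\<close> assms(8) by simp
  have Fbar: "Fbar y = profile y" if "y \<ge> 0" for y
    using assms(10-12) that unfolding assms(9)
    by (intro profile_unique) (simp_all add: cardano_def)
  \<comment> \<open>The constant \<open>c\<close> is chosen so that \<open>F0\<close> and the profile of parameter \<open>c\<close> grow alike.\<close>
  have \<delta>: "\<delta> = 3/2 * c powr (- 1/3)"
  proof -
    have "c = (3 / (2 * \<delta>)) powr 3"
      using \<open>\<delta> > 0\<close> assms(8) by (simp add: power3_eq_cube)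
    hence "c powr (- 1/3) = (3 / (2 * \<delta>)) powr (- 1)"
      by (simp add: powr_powr)
    also have "\<dots> = 2 * \<delta> / 3"
      using \<open>\<delta> > 0\<close> by (simp add: powr_minus_divide)
    finally show ?thesis by simp
  qed
  have pos: "\<forall>\<^sub>F x in at_top. x powr (2/3) > (0::real)"
    using eventually_gt_at_top[of 0] by eventually_elim simp
  obtain B where B: "B \<ge> 1" "\<And>x. x \<in> K \<Longrightarrow> x \<le> B"
  proof -
    from compact_imp_bounded[OF K(1)] obtain b where "\<And>x. x \<in> K \<Longrightarrow> norm x \<le> b"
      by (auto simp: bounded_iff)
    thus ?thesis by (intro that[of "max b 1"]) fastforce+
  qed
  show "uniform_limit K (\<lambda>t x. F (x, t)) (\<lambda>x. 1 / c * Fbar (c * x)) at_top"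
    unfolding uniform_limit_iff
  proof (intro allI impI)
    fix e :: real assume e: "e > 0"
    \<comment> \<open>On \<open>K\<close>, moving the parameter from \<open>c\<close> to \<open>c (1 \<plusminus> \<epsilon>)\<close> costs at most \<open>2 \<epsilon> B \<le> e / 2\<close>;\<close>
    \<comment> \<open>the other half of \<open>e\<close> is for the decaying waves.\<close>
    define \<epsilon> where "\<epsilon> = min (1/2) (e / (4 * B))"
    have \<epsilon>: "0 < \<epsilon>" "\<epsilon> < 1" using e B(1) by (auto simp: \<epsilon>_def)
    have "\<epsilon> \<le> e / (4 * B)" by (simp add: \<epsilon>_def)
    hence \<epsilon>B: "2 * \<epsilon> * B \<le> e / 2" using B(1) by (simp add: field_simps)
    define a where "a = c * (1 - \<epsilon>)"
    define b where "b = c * (1 + \<epsilon>)"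
    have ab: "0 < a" "a < c" "c < b" "0 < b"
      using c \<epsilon> by (auto simp: a_def b_def algebra_simps add_pos_pos)
    have close: "2 * \<bar>a - c\<bar> / c = 2 * \<epsilon>" "2 * \<bar>b - c\<bar> / c = 2 * \<epsilon>"
      using c \<epsilon> by (auto simp: a_def b_def algebra_simps abs_mult)
    have "\<forall>\<^sub>F x in at_top. F0 x \<le> profile (a * x) / a"
      using ab \<delta> by (intro eventually_le_of_ratio_limits[OF assms(6)
            rescaled_profile_asymptotics _ pos]) (auto intro: powr_less_mono2_neg)
    from CF_solution_le_profile[OF assms(7) ab(1) this] obtain k where k: "k > 0"
      "\<And>x t. x \<ge> 0 \<Longrightarrow> t \<ge> 0 \<Longrightarrow> F (x, t) \<le> profile (a * x) / a + exp (- (k * x + k / 2 * t)) / k"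
      by blast
    have "\<forall>\<^sub>F x in at_top. profile (b * x) / b \<le> F0 x"
      using ab c \<delta> by (intro eventually_le_of_ratio_limits[OF
            rescaled_profile_asymptotics assms(6) _ pos]) (auto intro: powr_less_mono2_neg)
    from CF_solution_ge_profile[OF assms(7) ab(4) this] obtain l where l: "l > 0"
      "\<And>x t. x \<ge> 0 \<Longrightarrow> t \<ge> 0 \<Longrightarrow> profile (b * x) / b - exp (- (l * x + l / 2 * t)) / l \<le> F (x, t)"
      by blast
    have decay: "\<forall>\<^sub>F t in at_top. exp (- (k / 2 * t)) / k < e / 2" if "k > 0" for k :: real
    proof -
      have "((\<lambda>t. exp (- (k / 2 * t)) / k) \<longlongrightarrow> 0) at_top"
        using that by real_asymp
      thus ?thesis using e by (intro order_tendstoD) auto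
    qed
    have exp_le: "exp (- (k * x + k / 2 * t)) / k \<le> exp (- (k / 2 * t)) / k"
      if "k > 0" "x \<ge> 0" for k x t :: real
      using that by (intro divide_right_mono) auto
    from decay[OF k(1)] decay[OF l(1)] eventually_ge_at_top[of 0]
    show "\<forall>\<^sub>F t in at_top. \<forall>x\<in>K. dist (F (x, t)) (1 / c * Fbar (c * x)) < e"
    proof eventually_elim
      case (elim t)
      show ?case
      proof
        fix x assume "x \<in> K"
        hence x: "x \<ge> 0" "x \<le> B" using K(2) B(2) by auto
        have "2 * \<epsilon> * x \<le> e / 2"
          using x(2) \<epsilon>(1) \<epsilon>B by (intro order.trans[OF mult_left_mono \<epsilon>B]) auto
        with rescaled_profile_dist[OF ab(1) c x(1)] rescaled_profile_dist[OF ab(4) c x(1)]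
        have "\<bar>profile (a * x) / a - profile (c * x) / c\<bar> \<le> e / 2"
          "\<bar>profile (b * x) / b - profile (c * x) / c\<bar> \<le> e / 2"
          by (simp_all add: close)
        moreover have "1 / c * Fbar (c * x) = profile (c * x) / c"
          using Fbar[of "c * x"] c x(1) by simp
        ultimately show "dist (F (x, t)) (1 / c * Fbar (c * x)) < e"
          using k(2)[OF x(1) elim(3)] l(2)[OF x(1) elim(3)] elim(1,2)
            exp_le[OF k(1) x(1), of t] exp_le[OF l(1) x(1), of t]
          unfolding dist_real_def by linarith
      qed
    qed
  qed
qed

end
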